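(* $\mathfrak{L}(\mathbf{H})^w_{O(n)} \subsetneq \mathfrak{L}(SL(3,\mathbb{Z}))^w_{O(n)}$.
   Context: For a group $G$ with identity $e$, a $G$-automaton is a tuple $(Q,\Sigma,G,\delta,q_0,Q_a)$ where $Q$ is a finite set of states, $\Sigma$ a finite input alphabet, $q_0\in Q$ the initial state, $Q_a\subseteq Q$ the accepting states, and $\delta$ assigns to each $(q,\sigma)\in Q\times(\Sigma\cup\{\varepsilon\})$ a finite set of pairs $(q',m)\in Q\times G$. The register holds an element of $G$, initially $e$; using a transition $(q',m)\in\delta(q,\sigma)$ (one step) the automaton reads $\sigma$ (or nothing), moves to $q'$ and replaces the register content $x$ by $xm$. A word is accepted if some computation reads it entirely and ends in an accepting state with register equal to $e$. A $G$-automaton recognizing $\mathtt{L}$ is weakly $t(n)$ time-bounded if every $x\in\mathtt{L}$ with $|x|=n$ has an accepting computation of at most $t(n)$ steps; $\mathfrak{L}(G)^w_{O(n)}$ is the class of languages recognized by weakly $t(n)$ time-bounded $G$-automata for some $t(n)=O(n)$. $\mathbf{H}$ is the discrete Heisenberg group of $3\times3$ upper unitriangular integer matrices (presentation $\langle a,b\mid ab=bac, ac=ca, bc=cb\rangle$, $c=a^{-1}b^{-1}ab$); $SL(3,\mathbb{Z})$ is the group of $3\times3$ integer matrices of determinant $1$. *)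

theory Defs
  imports "HOL-Analysis.Determinants" "HOL-Algebra.Group" "HOL-Library.Landau_Symbols"
begin

section \<open>G-automata\<close>

text \<open>A G-automaton is a tuple (Q, Sigma, G, delta, q0, Qa).  States are natural numbers
(Q a finite set of them), input symbols are of type 'a (Sigma a finite set of them),
and delta q None are the epsilon-transitions, delta q (Some s) the transitions reading s.\<close>

definition is_G_automaton ::
  "('g, 'b) monoid_scheme \<Rightarrow> nat set \<Rightarrow> 'a set \<Rightarrow> (nat \<Rightarrow> 'a option \<Rightarrow> (nat \<times> 'g) set)
   \<Rightarrow> nat \<Rightarrow> nat set \<Rightarrow> bool" where
  "is_G_automaton G Q \<Sigma> \<delta> q0 Qa \<longleftrightarrow>
     finite Q \<and> finite \<Sigma> \<and> q0 \<in> Q \<and> Qa \<subseteq> Q \<and>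
     (\<forall>q s. finite (\<delta> q s) \<and> \<delta> q s \<subseteq> Q \<times> carrier G) \<and>
     (\<forall>q s. (q \<notin> Q \<or> s \<notin> insert None (Some ` \<Sigma>)) \<longrightarrow> \<delta> q s = {})"

text \<open>comp G delta q x w k q' y: starting in state q with register content x, the automaton
can read the word w entirely in exactly k steps, ending in state q' with register content y.
A step using (q', m) replaces the register content x by x * m.\<close>

inductive comp ::
  "('g, 'b) monoid_scheme \<Rightarrow> (nat \<Rightarrow> 'a option \<Rightarrow> (nat \<times> 'g) set)
   \<Rightarrow> nat \<Rightarrow> 'g \<Rightarrow> 'a list \<Rightarrow> nat \<Rightarrow> nat \<Rightarrow> 'g \<Rightarrow> bool"
  for G \<delta> where
  comp_nil: "comp G \<delta> q x [] 0 q x"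
| comp_eps: "(q', m) \<in> \<delta> q None \<Longrightarrow> comp G \<delta> q' (x \<otimes>\<^bsub>G\<^esub> m) w k q'' y
             \<Longrightarrow> comp G \<delta> q x w (Suc k) q'' y"
| comp_read: "(q', m) \<in> \<delta> q (Some s) \<Longrightarrow> comp G \<delta> q' (x \<otimes>\<^bsub>G\<^esub> m) w k q'' y
             \<Longrightarrow> comp G \<delta> q x (s # w) (Suc k) q'' y"

text \<open>An accepting computation of w with k steps.\<close>
definition accepts_in ::
  "('g, 'b) monoid_scheme \<Rightarrow> (nat \<Rightarrow> 'a option \<Rightarrow> (nat \<times> 'g) set) \<Rightarrow> nat \<Rightarrow> nat set
   \<Rightarrow> 'a list \<Rightarrow> nat \<Rightarrow> bool" where
  "accepts_in G \<delta> q0 Qa w k \<longleftrightarrow>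
     (\<exists>qf. qf \<in> Qa \<and> comp G \<delta> q0 \<one>\<^bsub>G\<^esub> w k qf \<one>\<^bsub>G\<^esub>)"

definition G_lang ::
  "('g, 'b) monoid_scheme \<Rightarrow> (nat \<Rightarrow> 'a option \<Rightarrow> (nat \<times> 'g) set) \<Rightarrow> nat \<Rightarrow> nat set
   \<Rightarrow> 'a list set" where
  "G_lang G \<delta> q0 Qa = {w. \<exists>k. accepts_in G \<delta> q0 Qa w k}"

definition weakly_time_bounded ::
  "('g, 'b) monoid_scheme \<Rightarrow> (nat \<Rightarrow> 'a option \<Rightarrow> (nat \<times> 'g) set) \<Rightarrow> nat \<Rightarrow> nat set
   \<Rightarrow> (nat \<Rightarrow> nat) \<Rightarrow> bool" where
  "weakly_time_bounded G \<delta> q0 Qa t \<longleftrightarrow>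
     (\<forall>w \<in> G_lang G \<delta> q0 Qa. \<exists>k \<le> t (length w). accepts_in G \<delta> q0 Qa w k)"

text \<open>The class L(G)^w_{O(n)} of languages (over symbols of type 'a).\<close>
definition lin_weak_class :: "('g, 'b) monoid_scheme \<Rightarrow> 'a list set set" where
  "lin_weak_class G = {L. \<exists>Q \<Sigma> \<delta> q0 Qa t.
      is_G_automaton G Q \<Sigma> \<delta> q0 Qa \<and> L = G_lang G \<delta> q0 Qa \<and>
      (\<lambda>n. real (t n)) \<in> O(\<lambda>n. real n) \<and> weakly_time_bounded G \<delta> q0 Qa t}"

section \<open>The groups\<close>

text \<open>Discrete Heisenberg group: 3x3 upper unitriangular integer matrices.\<close>
definition Heisenberg :: "(int^3^3) monoid" where
  "Heisenberg = \<lparr> carrier = {A. \<forall>i j. (j < i \<longrightarrow> A $ i $ j = 0) \<and> (i = j \<longrightarrow> A $ i $ j = 1)},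
                 mult = (\<lambda>A B. A ** B), one = mat 1 \<rparr>"

text \<open>SL(3,Z): 3x3 integer matrices of determinant 1.\<close>
definition SL3Z :: "(int^3^3) monoid" where
  "SL3Z = \<lparr> carrier = {A. det A = 1}, mult = (\<lambda>A B. A ** B), one = mat 1 \<rparr>"

end

theory Submission
  imports Defs "HOL-Real_Asymp.Real_Asymp"
begin

(* The Heisenberg group is a submonoid of SL(3,Z) with the same product and unit, so every
   Heisenberg automaton is an SL(3,Z) automaton with the same computations.

   For strictness take the marked palindromes u 2 rev u with u over {0,1}.  The transvections
   I + E01 and I + E10 generate a free monoid in SL(3,Z): the first letter of a word is read off
   by comparing the first two row sums of its matrix.  So an SL(3,Z) automaton multiplying by the
   generators along u and by their inverses along the second half accepts in real time.
   Conversely, in a Heisenberg automaton with transition labels of size at most r the register after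
   k steps has entries of size at most k r (above the diagonal) and (k r)^2 (in the corner).  If it
   runs in time O(n), then after the prefixes u of length m it can only be in polynomially many
   configurations, while the 2^m prefixes must reach pairwise distinct ones: otherwise it would
   also accept a word v 2 rev u with v ~= u. *)

section \<open>Upper unitriangular 3 by 3 matrices\<close>

text \<open>Matrix entries are indexed by \<open>0 < 1 < 2\<close> in type \<open>3\<close>, whereas the library
  enumerates this type as \<open>1, 2, 3\<close> with \<open>3 = 0\<close>.\<close>

lemma UNIV_3_from_0: "UNIV = {0, 1, 2::3}"
proof -
  have "(3::3) = 0" by simp
  then show ?thesis using UNIV_3 by auto
qed

lemma sum_UNIV_3: "sum f (UNIV::3 set) = f 0 + f 1 + f 2"
  unfolding UNIV_3_from_0 by (simp add: ac_simps)

lemma forall_3_from_0: "(\<forall>i::3. P i) \<longleftrightarrow> P 0 \<and> P 1 \<and> P 2"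
  using UNIV_3_from_0 by (metis UNIV_I insertE singletonD)

lemma less_3_iff: "(j::3) < i \<longleftrightarrow> j = 0 \<and> i = 1 \<or> j = 0 \<and> i = 2 \<or> j = 1 \<and> i = 2"
proof -
  have lt: "(0::3) < 1" "(1::3) < 2" "(0::3) < 2"
    by (simp_all add: less_bit1_def bit1.Rep_0 bit1.Rep_1 bit1.Rep_numeral)
  then have not_lt: "\<not> (1::3) < 0" "\<not> (2::3) < 0" "\<not> (2::3) < 1"
    by (simp_all add: not_less less_imp_le)
  have "i = 0 \<or> i = 1 \<or> i = 2" "j = 0 \<or> j = 1 \<or> j = 2" using UNIV_3_from_0 by blast+
  then show ?thesis by (elim disjE) (simp_all add: lt not_lt)
qed

lemma Heisenberg_simps [simp]: "mult Heisenberg = (**)" "one Heisenberg = mat 1"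
  by (simp_all add: Heisenberg_def)

lemma SL3Z_simps [simp]: "mult SL3Z = (**)" "one SL3Z = mat 1" "A \<in> carrier SL3Z \<longleftrightarrow> det A = 1"
  by (simp_all add: SL3Z_def)

lemma Heisenberg_carrier_iff:
  "A \<in> carrier Heisenberg \<longleftrightarrow>
     A$0$0 = 1 \<and> A$1$1 = 1 \<and> A$2$2 = 1 \<and> A$1$0 = 0 \<and> A$2$0 = 0 \<and> A$2$1 = 0"
  unfolding Heisenberg_def partial_object.simps mem_Collect_eq forall_3_from_0 less_3_iff
  by auto

lemma Heisenberg_eqI:
  assumes "A \<in> carrier Heisenberg" "B \<in> carrier Heisenberg"
    and "A$0$1 = B$0$1" "A$1$2 = B$1$2" "A$0$2 = B$0$2"
  shows "A = B"
  using assms unfolding Heisenberg_carrier_iff vec_eq_iff forall_3_from_0 by simp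

lemma Heisenberg_mult:
  assumes "A \<in> carrier Heisenberg" "B \<in> carrier Heisenberg"
  shows "A ** B \<in> carrier Heisenberg"
    and "(A ** B)$0$1 = A$0$1 + B$0$1" "(A ** B)$1$2 = A$1$2 + B$1$2"
    and "(A ** B)$0$2 = A$0$2 + A$0$1 * B$1$2 + B$0$2"
  using assms unfolding Heisenberg_carrier_iff by (simp_all add: matrix_matrix_mult_def sum_UNIV_3)

lemma Heisenberg_carrier_subset_SL3Z: "carrier Heisenberg \<subseteq> carrier SL3Z"
proof
  fix A assume A: "A \<in> carrier Heisenberg"
  then have "det A = (\<Prod>i\<in>UNIV. A$i$i)"
    by (intro det_upperdiagonal) (auto simp: Heisenberg_def)
  also have "\<dots> = 1"
    using A unfolding Heisenberg_carrier_iff UNIV_3_from_0 by simp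
  finally show "A \<in> carrier SL3Z" by simp
qed

section \<open>Computations of G-automata\<close>

lemma comp_cong_mult:
  assumes "mult G = mult G'"
  shows "comp G \<delta> q x w k q' y \<longleftrightarrow> comp G' \<delta> q x w k q' y"
proof
  show "comp G \<delta> q x w k q' y \<Longrightarrow> comp G' \<delta> q x w k q' y"
    by (induction rule: comp.induct) (auto intro: comp.intros simp: assms)
  show "comp G' \<delta> q x w k q' y \<Longrightarrow> comp G \<delta> q x w k q' y"
    by (induction rule: comp.induct) (auto intro: comp.intros simp: assms)
qed

lemma lin_weak_class_mono:
  assumes "carrier G \<subseteq> carrier G'" "mult G = mult G'" "one G = one G'"
  shows "lin_weak_class G \<subseteq> lin_weak_class G'"
proof
  fix L assume "L \<in> lin_weak_class G"
  then obtain Q \<Sigma> \<delta> q0 Qa t where aut: "is_G_automaton G Q \<Sigma> \<delta> q0 Qa"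
    and L: "L = G_lang G \<delta> q0 Qa" and t: "(\<lambda>n. real (t n)) \<in> O(\<lambda>n. real n)"
    and time: "weakly_time_bounded G \<delta> q0 Qa t"
    unfolding lin_weak_class_def by blast
  have acc: "accepts_in G = accepts_in G'"
    using assms(2,3) by (intro ext) (simp add: accepts_in_def comp_cong_mult[OF assms(2)])
  have "is_G_automaton G' Q \<Sigma> \<delta> q0 Qa"
    using aut assms(1) unfolding is_G_automaton_def by blast
  moreover have "L = G_lang G' \<delta> q0 Qa"
    using L unfolding G_lang_def acc .
  moreover have "weakly_time_bounded G' \<delta> q0 Qa t"
    using time unfolding weakly_time_bounded_def G_lang_def acc .
  ultimately show "L \<in> lin_weak_class G'"
    using t unfolding lin_weak_class_def by blast
qed

lemma comp_append:
  "comp G \<delta> q x u k1 q' x' \<Longrightarrow> comp G \<delta> q' x' z k2 q'' y \<Longrightarrow> comp G \<delta> q x (u @ z) (k1 + k2) q'' y"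
  by (induction rule: comp.induct) (auto intro: comp.intros)

lemma comp_split:
  "comp G \<delta> q x (u @ z) k q'' y \<Longrightarrow>
   \<exists>k1 k2 q' x'. comp G \<delta> q x u k1 q' x' \<and> comp G \<delta> q' x' z k2 q'' y \<and> k = k1 + k2"
proof (induction "u @ z" k q'' y arbitrary: u rule: comp.induct)
  case (comp_nil q x)
  then show ?case by (auto intro: comp.intros)
next
  case (comp_eps q' m q x k q'' y)
  then show ?case by (metis add_Suc comp.comp_eps)
next
  case (comp_read q' m q s x w k q'' y)
  show ?case
  proof (cases u)
    case Nil
    then show ?thesis using comp.comp_read[OF comp_read(1,2)] comp_read(4)
      by (intro exI[of _ 0] exI[of _ "Suc k"] exI[of _ q] exI[of _ x]) (auto intro: comp.intros)
  next
    case (Cons a u')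
    then show ?thesis using comp_read by (metis add_Suc comp.comp_read list.inject append_Cons)
  qed
qed

lemma comp_state_in_states:
  "comp G \<delta> q x w k q' y \<Longrightarrow> is_G_automaton G Q \<Sigma> \<delta> q0 Qa \<Longrightarrow> q \<in> Q \<Longrightarrow> q' \<in> Q"
  by (induction rule: comp.induct) (auto simp: is_G_automaton_def)

definition transition_labels :: "(nat \<Rightarrow> 'a option \<Rightarrow> (nat \<times> 'g) set) \<Rightarrow> 'g set" where
  "transition_labels \<delta> = {m. \<exists>q s q'. (q', m) \<in> \<delta> q s}"

lemma transition_labels_finite:
  assumes "is_G_automaton G Q \<Sigma> \<delta> q0 Qa"
  shows "finite (transition_labels \<delta>)" and "transition_labels \<delta> \<subseteq> carrier G"
proof -
  have "transition_labels \<delta> \<subseteq> snd ` (\<Union>q\<in>Q. \<Union>s\<in>insert None (Some ` \<Sigma>). \<delta> q s)"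
  proof
    fix m assume "m \<in> transition_labels \<delta>"
    then obtain q s q' where m: "(q', m) \<in> \<delta> q s" unfolding transition_labels_def by blast
    then have "q \<in> Q" "s \<in> insert None (Some ` \<Sigma>)"
      using assms unfolding is_G_automaton_def by blast+
    with m show "m \<in> snd ` (\<Union>q\<in>Q. \<Union>s\<in>insert None (Some ` \<Sigma>). \<delta> q s)" by force
  qed
  moreover have "finite (\<Union>q\<in>Q. \<Union>s\<in>insert None (Some ` \<Sigma>). \<delta> q s)"
    using assms unfolding is_G_automaton_def by blast
  ultimately show "finite (transition_labels \<delta>)" using finite_subset by blast
  show "transition_labels \<delta> \<subseteq> carrier G"
    using assms unfolding is_G_automaton_def transition_labels_def by blast
qed

lemma comp_register_foldl:
  "comp G \<delta> q x w k q' y \<Longrightarrow>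
   \<exists>ms. length ms = k \<and> set ms \<subseteq> transition_labels \<delta> \<and> y = foldl (mult G) x ms"
proof (induction rule: comp.induct)
  case (comp_nil q x)
  show ?case by auto
next
  case (comp_eps q' m q x w k q'' y)
  then obtain ms where "length ms = k" "set ms \<subseteq> transition_labels \<delta>" "y = foldl (mult G) (x \<otimes>\<^bsub>G\<^esub> m) ms"
    by blast
  with comp_eps(1) show ?case
    by (intro exI[of _ "m # ms"]) (auto simp: transition_labels_def)
next
  case (comp_read q' m q s x w k q'' y)
  then obtain ms where "length ms = k" "set ms \<subseteq> transition_labels \<delta>" "y = foldl (mult G) (x \<otimes>\<^bsub>G\<^esub> m) ms"
    by blast
  with comp_read(1) show ?case
    by (intro exI[of _ "m # ms"]) (auto simp: transition_labels_def)
qed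

lemma fooling_set_card_le:
  fixes U :: "'a list set" and S :: "(nat \<times> 'g) set"
  assumes "finite S"
    and config: "\<And>u. u \<in> U \<Longrightarrow> \<exists>(q, x) \<in> S. (\<exists>k. comp G \<delta> q0 \<one>\<^bsub>G\<^esub> u k q x) \<and>
                   (\<exists>k qf. qf \<in> Qa \<and> comp G \<delta> q x (z u) k qf \<one>\<^bsub>G\<^esub>)"
    and fooling: "\<And>u v. u \<in> U \<Longrightarrow> v \<in> U \<Longrightarrow> v @ z u \<in> G_lang G \<delta> q0 Qa \<Longrightarrow> v = u"
  shows "card U \<le> card S"
proof -
  obtain c where c: "\<And>u. u \<in> U \<Longrightarrow> c u \<in> S \<and> (\<exists>k. comp G \<delta> q0 \<one>\<^bsub>G\<^esub> u k (fst (c u)) (snd (c u))) \<and>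
                   (\<exists>k qf. qf \<in> Qa \<and> comp G \<delta> (fst (c u)) (snd (c u)) (z u) k qf \<one>\<^bsub>G\<^esub>)"
    using config by (simp add: split_beta) metis
  have "inj_on c U"
  proof (rule inj_onI)
    fix u v assume u: "u \<in> U" and v: "v \<in> U" and "c u = c v"
    with c obtain k1 k2 qf where "comp G \<delta> q0 \<one>\<^bsub>G\<^esub> v k1 (fst (c u)) (snd (c u))"
      and "qf \<in> Qa" "comp G \<delta> (fst (c u)) (snd (c u)) (z u) k2 qf \<one>\<^bsub>G\<^esub>"
      by metis
    then have "v @ z u \<in> G_lang G \<delta> q0 Qa"
      unfolding G_lang_def accepts_in_def by (blast intro: comp_append)
    then show "u = v" using fooling[OF u v] by simp
  qed
  then show ?thesis using c by (intro card_inj_on_le[OF _ _ assms(1)]) auto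
qed

section \<open>Growth of the register of a Heisenberg automaton\<close>

definition Heisenberg_ball :: "nat \<Rightarrow> (int^3^3) set" where
  "Heisenberg_ball r = {A \<in> carrier Heisenberg. \<bar>A$0$1\<bar> \<le> int r \<and> \<bar>A$1$2\<bar> \<le> int r \<and> \<bar>A$0$2\<bar> \<le> int r}"

lemma Heisenberg_ball_mono: "r \<le> s \<Longrightarrow> Heisenberg_ball r \<subseteq> Heisenberg_ball s"
  unfolding Heisenberg_ball_def by auto

lemma Heisenberg_ball_finite_card:
  "finite (Heisenberg_ball r) \<and> card (Heisenberg_ball r) \<le> (2 * r + 1) ^ 3"
proof -
  let ?coords = "\<lambda>A :: int^3^3. (A$0$1, A$1$2, A$0$2)"
  let ?I = "{-int r..int r}"
  have inj: "inj_on ?coords (Heisenberg_ball r)"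
    by (rule inj_onI) (auto simp: Heisenberg_ball_def intro: Heisenberg_eqI)
  have sub: "?coords ` Heisenberg_ball r \<subseteq> ?I \<times> ?I \<times> ?I"
  proof (rule image_subsetI)
    fix A assume "A \<in> Heisenberg_ball r"
    then have "\<bar>A$0$1\<bar> \<le> int r" "\<bar>A$1$2\<bar> \<le> int r" "\<bar>A$0$2\<bar> \<le> int r"
      unfolding Heisenberg_ball_def by auto
    then show "?coords A \<in> ?I \<times> ?I \<times> ?I"
      unfolding mem_Times_iff fst_conv snd_conv atLeastAtMost_iff abs_le_iff by linarith
  qed
  have "card (Heisenberg_ball r) \<le> card (?I \<times> ?I \<times> ?I)"
    by (rule card_inj_on_le[OF inj sub]) simp
  also have "\<dots> = (2 * r + 1) ^ 3"
  proof -
    have "int r - - int r + 1 = int (2 * r + 1)" by simp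
    then have "card ?I = 2 * r + 1" by (simp only: card_atLeastAtMost_int nat_int)
    then show ?thesis by (simp only: card_cartesian_product power3_eq_cube)
  qed
  finally show ?thesis using inj_on_finite[OF inj sub] by simp
qed

lemma Heisenberg_ball_covers_finite:
  assumes "finite S" "S \<subseteq> carrier Heisenberg"
  shows "\<exists>r. S \<subseteq> Heisenberg_ball r"
proof
  let ?r = "Max (insert 0 ((\<lambda>A. nat (\<bar>A$0$1\<bar> + \<bar>A$1$2\<bar> + \<bar>A$0$2\<bar>)) ` S))"
  show "S \<subseteq> Heisenberg_ball ?r"
  proof
    fix A assume "A \<in> S"
    then have "nat (\<bar>A$0$1\<bar> + \<bar>A$1$2\<bar> + \<bar>A$0$2\<bar>) \<le> ?r" using assms(1) by simp
    then show "A \<in> Heisenberg_ball ?r"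
      using \<open>A \<in> S\<close> assms(2) unfolding Heisenberg_ball_def by auto
  qed
qed

lemma Heisenberg_foldl_bound:
  assumes "set ms \<subseteq> Heisenberg_ball r"
  shows "foldl (**) (mat 1) ms \<in> carrier Heisenberg
    \<and> \<bar>(foldl (**) (mat 1) ms)$0$1\<bar> \<le> int (length ms * r)
    \<and> \<bar>(foldl (**) (mat 1) ms)$1$2\<bar> \<le> int (length ms * r)
    \<and> \<bar>(foldl (**) (mat 1) ms)$0$2\<bar> \<le> int ((length ms * r)\<^sup>2)"
  using assms
proof (induction ms rule: rev_induct)
  case Nil
  show ?case by (simp add: Heisenberg_carrier_iff mat_def)
next
  case (snoc m ms)
  define A where "A = foldl (**) (mat 1) ms"
  define k where "k = int (length ms)"
  have A: "A \<in> carrier Heisenberg" "\<bar>A$0$1\<bar> \<le> k * r" "\<bar>A$1$2\<bar> \<le> k * r" "\<bar>A$0$2\<bar> \<le> (k * r)\<^sup>2"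
    using snoc unfolding A_def k_def by auto
  have m: "m \<in> carrier Heisenberg" "\<bar>m$0$1\<bar> \<le> r" "\<bar>m$1$2\<bar> \<le> r" "\<bar>m$0$2\<bar> \<le> r"
    using snoc.prems unfolding Heisenberg_ball_def by auto
  have "\<bar>A$0$1 * m$1$2\<bar> \<le> (k * r) * r"
    unfolding abs_mult using A m by (intro mult_mono) auto
  moreover have "int r \<le> r * r"
    using le_square[of r] by (metis of_nat_le_iff of_nat_mult)
  moreover have "0 \<le> k * r * r" by (simp add: k_def)
  ultimately have "\<bar>A$0$2 + A$0$1 * m$1$2 + m$0$2\<bar> \<le> ((k + 1) * r)\<^sup>2"
    using A(4) m(4) by (simp add: power2_eq_square algebra_simps)
  moreover have "\<bar>A$0$1 + m$0$1\<bar> \<le> (k + 1) * r" "\<bar>A$1$2 + m$1$2\<bar> \<le> (k + 1) * r"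
    using A(2,3) m(2,3) abs_triangle_ineq[of "A$0$1" "m$0$1"] abs_triangle_ineq[of "A$1$2" "m$1$2"]
    by (simp_all add: distrib_right)
  ultimately show ?case
    using Heisenberg_mult[OF A(1) m(1)] by (simp add: A_def k_def algebra_simps)
qed

lemma comp_Heisenberg_register_bound:
  assumes "transition_labels \<delta> \<subseteq> Heisenberg_ball r"
    and "comp Heisenberg \<delta> q (mat 1) w k q' y"
  shows "y \<in> Heisenberg_ball ((k * r)\<^sup>2)"
proof -
  obtain ms where ms: "length ms = k" "set ms \<subseteq> Heisenberg_ball r" "y = foldl (**) (mat 1) ms"
    using comp_register_foldl[OF assms(2)] assms(1) by auto
  have "int k * int r \<le> (int k * int r)\<^sup>2"
    using le_square[of "k * r"] by (metis of_nat_le_iff of_nat_mult power2_eq_square)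
  then show ?thesis
    using Heisenberg_foldl_bound[OF ms(2)] unfolding ms(1,3) Heisenberg_ball_def by auto
qed

section \<open>A free monoid in SL(3,Z)\<close>

definition transvection :: "'n::finite \<Rightarrow> 'n \<Rightarrow> 'a::comm_ring_1 \<Rightarrow> 'a^'n^'n" where
  "transvection i j c = mat 1 + (\<chi> k l. if k = i \<and> l = j then c else 0)"

lemma transvection_mult_vec:
  "(transvection i j c *v x) $ k = (if k = i then x $ i + c * x $ j else x $ k)"
proof -
  have "((\<chi> k l. if k = i \<and> l = j then c else 0) *v x) $ k = (if k = i then c * x $ j else 0)"
    by (cases "k = i") (simp_all add: matrix_vector_mult_def if_distrib[of "\<lambda>a. a * _"] cong: if_cong)
  then show ?thesis by (simp add: transvection_def matrix_vector_mult_add_rdistrib)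
qed

lemma transvection_add:
  assumes "i \<noteq> j"
  shows "transvection i j c ** transvection i j d = transvection i j (c + d)"
  unfolding matrix_eq using assms
  by (auto simp flip: matrix_vector_mul_assoc simp: vec_eq_iff transvection_mult_vec algebra_simps)

lemma transvection_zero: "transvection i j 0 = mat 1"
  by (simp add: transvection_def vec_eq_iff)

lemma det_transvection:
  assumes "i \<noteq> j"
  shows "det (transvection i j c) = 1"
proof -
  have "transvection i j c = (\<chi> k. if k = i then row i (mat 1) + c *s row j (mat 1) else row k (mat 1))"
    using assms by (auto simp: transvection_def vec_eq_iff row_def mat_def)
  then show ?thesis using det_row_operation[OF assms, of "mat 1"] by simp
qed

definition letter_matrix :: "int \<Rightarrow> nat \<Rightarrow> int^3^3" where
  "letter_matrix c a = (if a = 0 then transvection 0 1 c else transvection 1 0 c)"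

fun word_matrix :: "int \<Rightarrow> nat list \<Rightarrow> int^3^3" where
  "word_matrix c [] = mat 1"
| "word_matrix c (a # u) = letter_matrix c a ** word_matrix c u"

lemma letter_matrix_inverse: "letter_matrix c a ** letter_matrix (- c) a = mat 1"
  by (simp add: letter_matrix_def transvection_add transvection_zero)

lemma det_letter_matrix: "det (letter_matrix c a) = 1"
  by (simp add: letter_matrix_def det_transvection)

lemma word_matrix_append: "word_matrix c (u @ v) = word_matrix c u ** word_matrix c v"
  by (induction u) (simp_all add: matrix_mul_assoc)

lemma word_matrix_rev_inverse: "word_matrix c u ** word_matrix (- c) (rev u) = mat 1"
proof (induction u)
  case (Cons a u)
  have "word_matrix c (a # u) ** word_matrix (- c) (rev (a # u))
      = letter_matrix c a ** (word_matrix c u ** word_matrix (- c) (rev u)) ** letter_matrix (- c) a"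
    by (simp add: word_matrix_append matrix_mul_assoc)
  then show ?case by (simp add: Cons letter_matrix_inverse)
qed simp

definition row_sums :: "int^3^3 \<Rightarrow> int^3" where
  "row_sums A = A *v 1"

lemma row_sums_letter_matrix:
  "row_sums (letter_matrix 1 a ** A) $ 0 = (if a = 0 then row_sums A $ 0 + row_sums A $ 1 else row_sums A $ 0)"
  "row_sums (letter_matrix 1 a ** A) $ 1 = (if a = 0 then row_sums A $ 1 else row_sums A $ 1 + row_sums A $ 0)"
  by (simp_all add: row_sums_def letter_matrix_def transvection_mult_vec flip: matrix_vector_mul_assoc)

lemma row_sums_word_matrix_pos:
  "set u \<subseteq> {0,1} \<Longrightarrow> 1 \<le> row_sums (word_matrix 1 u) $ 0 \<and> 1 \<le> row_sums (word_matrix 1 u) $ 1"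
proof (induction u)
  case Nil
  show ?case by (simp add: row_sums_def)
next
  case (Cons a u)
  then show ?case by (auto simp: row_sums_letter_matrix)
qed

lemma row_sums_word_matrix_Cons:
  assumes "set (a # u) \<subseteq> {0,1}"
  shows "row_sums (word_matrix 1 (a # u)) $ 0 \<noteq> row_sums (word_matrix 1 (a # u)) $ 1"
    and "a = 0 \<longleftrightarrow> row_sums (word_matrix 1 (a # u)) $ 1 < row_sums (word_matrix 1 (a # u)) $ 0"
  using assms row_sums_word_matrix_pos[of u] by (auto simp: row_sums_letter_matrix)

lemma word_matrix_eq_1:
  assumes "set u \<subseteq> {0,1}" "word_matrix 1 u = mat 1"
  shows "u = []"
proof (rule ccontr)
  assume "u \<noteq> []"
  then obtain a u' where "u = a # u'" by (cases u) auto
  then show False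
    using assms row_sums_word_matrix_Cons(1)[of a u'] by (simp add: row_sums_def)
qed

lemma word_matrix_inj:
  "set u \<subseteq> {0,1} \<Longrightarrow> set v \<subseteq> {0,1} \<Longrightarrow> word_matrix 1 u = word_matrix 1 v \<Longrightarrow> u = v"
proof (induction u arbitrary: v)
  case Nil
  then show ?case using word_matrix_eq_1[of v] by simp
next
  case (Cons a u)
  show ?case
  proof (cases v)
    case Nil
    then show ?thesis using Cons.prems word_matrix_eq_1[of "a # u"] by simp
  next
    case (Cons b v')
    have "a = b"
      using Cons.prems row_sums_word_matrix_Cons(2)[of a u] row_sums_word_matrix_Cons(2)[of b v']
      unfolding Cons by (auto simp del: word_matrix.simps)
    have "word_matrix 1 u = letter_matrix (- 1) a ** (letter_matrix 1 a ** word_matrix 1 u)"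
      by (simp add: matrix_mul_assoc letter_matrix_inverse[of "- 1", simplified])
    also have "\<dots> = word_matrix 1 v'"
      using Cons.prems \<open>a = b\<close> unfolding Cons
      by (simp add: matrix_mul_assoc letter_matrix_inverse[of "- 1", simplified])
    finally show ?thesis using Cons.IH Cons.prems \<open>a = b\<close> unfolding Cons by simp
  qed
qed

section \<open>Marked palindromes\<close>

definition marked_palindromes :: "nat list set" where
  "marked_palindromes = {u @ 2 # rev u | u. set u \<subseteq> {0,1}}"

lemma marked_palindrome_prefix_unique:
  assumes "set u \<subseteq> {0,1}" "set v \<subseteq> {0,1}" "v @ 2 # rev u \<in> marked_palindromes"
  shows "v = u"
proof -
  obtain x where x: "set x \<subseteq> {0,1}" "v @ 2 # rev u = x @ 2 # rev x"
    using assms(3) unfolding marked_palindromes_def by blast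
  have "2 \<notin> set v" "2 \<notin> set (rev u)" using assms(1,2) by auto
  then have "v = x \<and> rev u = rev x"
    using append_Cons_eq_iff x(2) by metis
  then show ?thesis by simp
qed

definition palindrome_automaton :: "nat \<Rightarrow> nat option \<Rightarrow> (nat \<times> (int^3^3)) set" where
  "palindrome_automaton q s = (case s of None \<Rightarrow> {} | Some a \<Rightarrow>
     if q = 0 \<and> a \<in> {0,1} then {(0, letter_matrix 1 a)}
     else if q = 0 \<and> a = 2 then {(1, mat 1)}
     else if q = 1 \<and> a \<in> {0,1} then {(1, letter_matrix (- 1) a)}
     else {})"

lemma palindrome_automaton_is_G_automaton:
  "is_G_automaton SL3Z {0,1} {0,1,2} palindrome_automaton 0 {1}"
  unfolding is_G_automaton_def
  by (auto simp: palindrome_automaton_def det_letter_matrix split: option.splits)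

lemma comp_palindrome_automaton_from_1:
  "comp SL3Z palindrome_automaton q x w k q' y \<Longrightarrow> q = 1 \<Longrightarrow>
   q' = 1 \<and> set w \<subseteq> {0,1} \<and> y = x ** word_matrix (- 1) w"
  by (induction rule: comp.induct)
    (auto simp: palindrome_automaton_def matrix_mul_assoc split: if_splits)

lemma comp_palindrome_automaton_0_to_1:
  "comp SL3Z palindrome_automaton q x w k q' y \<Longrightarrow> q = 0 \<Longrightarrow> q' = 1 \<Longrightarrow>
   \<exists>u v. w = u @ 2 # v \<and> set u \<subseteq> {0,1} \<and> set v \<subseteq> {0,1} \<and>
     y = x ** word_matrix 1 u ** word_matrix (- 1) v"
proof (induction rule: comp.induct)
  case (comp_read q1 m q s x w k q' y)
  show ?case
  proof (cases "s = 2")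
    case True
    then have "q1 = 1" "m = mat 1"
      using comp_read by (auto simp: palindrome_automaton_def)
    then have "set w \<subseteq> {0,1}" "y = x ** word_matrix (- 1) w"
      using comp_palindrome_automaton_from_1[OF comp_read(2)] by simp_all
    then show ?thesis using True by (intro exI[of _ "[]"] exI[of _ w]) simp
  next
    case False
    then have "s \<in> {0,1}" "q1 = 0" "m = letter_matrix 1 s"
      using comp_read by (auto simp: palindrome_automaton_def split: if_splits)
    then obtain u v where "w = u @ 2 # v" "set u \<subseteq> {0,1}" "set v \<subseteq> {0,1}"
      "y = x ** letter_matrix 1 s ** word_matrix 1 u ** word_matrix (- 1) v"
      using comp_read by auto
    then show ?thesis using \<open>s \<in> {0,1}\<close>
      by (intro exI[of _ "s # u"] exI[of _ v]) (simp add: matrix_mul_assoc)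
  qed
qed (auto simp: palindrome_automaton_def)

lemma comp_palindrome_automaton_read_0:
  "set u \<subseteq> {0,1} \<Longrightarrow> comp SL3Z palindrome_automaton 0 x u (length u) 0 (x ** word_matrix 1 u)"
proof (induction u arbitrary: x)
  case (Cons a u)
  then have "comp SL3Z palindrome_automaton 0 (x ** letter_matrix 1 a) u (length u) 0 (x ** word_matrix 1 (a # u))"
    by (simp add: matrix_mul_assoc)
  moreover have "(0, letter_matrix 1 a) \<in> palindrome_automaton 0 (Some a)"
    using Cons.prems by (simp add: palindrome_automaton_def)
  ultimately show ?case by (simp add: comp.comp_read)
qed (simp add: comp.comp_nil)

lemma comp_palindrome_automaton_read_1:
  "set v \<subseteq> {0,1} \<Longrightarrow> comp SL3Z palindrome_automaton 1 x v (length v) 1 (x ** word_matrix (- 1) v)"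
proof (induction v arbitrary: x)
  case (Cons a v)
  then have "comp SL3Z palindrome_automaton 1 (x ** letter_matrix (- 1) a) v (length v) 1 (x ** word_matrix (- 1) (a # v))"
    by (simp add: matrix_mul_assoc)
  moreover have "(1, letter_matrix (- 1) a) \<in> palindrome_automaton 1 (Some a)"
    using Cons.prems by (simp add: palindrome_automaton_def)
  ultimately show ?case by (simp add: comp.comp_read)
qed (simp add: comp.comp_nil)

lemma palindrome_automaton_accepts_in_linear_time:
  assumes "w \<in> marked_palindromes"
  shows "accepts_in SL3Z palindrome_automaton 0 {1} w (length w)"
proof -
  obtain u where u: "w = u @ 2 # rev u" "set u \<subseteq> {0,1}"
    using assms unfolding marked_palindromes_def by blast
  have "comp SL3Z palindrome_automaton 1 (word_matrix 1 u \<otimes>\<^bsub>SL3Z\<^esub> mat 1) (rev u) (length u) 1 (mat 1)"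
    using comp_palindrome_automaton_read_1[of "rev u" "word_matrix 1 u"] u(2)
    by (simp add: word_matrix_rev_inverse)
  then have "comp SL3Z palindrome_automaton 0 (word_matrix 1 u) (2 # rev u) (Suc (length u)) 1 (mat 1)"
    by (rule comp.comp_read[rotated]) (simp add: palindrome_automaton_def)
  with comp_palindrome_automaton_read_0[OF u(2), of "mat 1"] show ?thesis
    unfolding accepts_in_def u(1) by (auto dest: comp_append)
qed

lemma G_lang_palindrome_automaton:
  "G_lang SL3Z palindrome_automaton 0 {1} = marked_palindromes"
proof
  show "marked_palindromes \<subseteq> G_lang SL3Z palindrome_automaton 0 {1}"
    using palindrome_automaton_accepts_in_linear_time unfolding G_lang_def by blast
  show "G_lang SL3Z palindrome_automaton 0 {1} \<subseteq> marked_palindromes"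
  proof
    fix w assume "w \<in> G_lang SL3Z palindrome_automaton 0 {1}"
    then obtain k where "comp SL3Z palindrome_automaton 0 (mat 1) w k 1 (mat 1)"
      unfolding G_lang_def accepts_in_def by auto
    then obtain u v where uv: "w = u @ 2 # v" "set u \<subseteq> {0,1}" "set v \<subseteq> {0,1}"
      and inv: "word_matrix 1 u ** word_matrix (- 1) v = mat 1"
      using comp_palindrome_automaton_0_to_1 by fastforce
    have "word_matrix 1 u = word_matrix 1 u ** word_matrix (- 1) v ** word_matrix 1 (rev v)"
      using word_matrix_rev_inverse[of "- 1" v] by (simp flip: matrix_mul_assoc)
    then have "word_matrix 1 u = word_matrix 1 (rev v)" by (simp add: inv)
    then have "u = rev v" using word_matrix_inj uv(2,3) by simp
    then have "w = u @ 2 # rev u" using uv(1) by simp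
    then show "w \<in> marked_palindromes"
      unfolding marked_palindromes_def using uv(2) by blast
  qed
qed

lemma marked_palindromes_in_lin_weak_class_SL3Z: "marked_palindromes \<in> lin_weak_class SL3Z"
  unfolding lin_weak_class_def
proof (intro CollectI exI conjI)
  show "is_G_automaton SL3Z {0,1} {0,1,2} palindrome_automaton 0 {1}"
    by (rule palindrome_automaton_is_G_automaton)
  show "marked_palindromes = G_lang SL3Z palindrome_automaton 0 {1}"
    by (rule G_lang_palindrome_automaton[symmetric])
  show "(\<lambda>n. real (id n)) \<in> O(\<lambda>n. real n)" by simp
  show "weakly_time_bounded SL3Z palindrome_automaton 0 {1} id"
    unfolding weakly_time_bounded_def G_lang_palindrome_automaton
    using palindrome_automaton_accepts_in_linear_time by auto
qed

lemma marked_palindromes_Heisenberg_count: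
  assumes aut: "is_G_automaton Heisenberg Q \<Sigma> \<delta> q0 Qa"
    and lang: "G_lang Heisenberg \<delta> q0 Qa = marked_palindromes"
    and time: "weakly_time_bounded Heisenberg \<delta> q0 Qa t"
    and labels: "transition_labels \<delta> \<subseteq> Heisenberg_ball r"
  shows "2 ^ m \<le> card Q * (2 * (t (2 * m + 1) * r)\<^sup>2 + 1) ^ 3"
proof -
  define U where "U = {u. set u \<subseteq> {0,1::nat} \<and> length u = m}"
  define R where "R = (t (2 * m + 1) * r)\<^sup>2"
  have "card U \<le> card (Q \<times> Heisenberg_ball R)"
  proof (rule fooling_set_card_le[where z = "\<lambda>u. 2 # rev u"])
    show "finite (Q \<times> Heisenberg_ball R)"
      using aut Heisenberg_ball_finite_card unfolding is_G_automaton_def by simp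
  next
    fix u v assume "u \<in> U" "v \<in> U" "v @ 2 # rev u \<in> G_lang Heisenberg \<delta> q0 Qa"
    then show "v = u"
      using marked_palindrome_prefix_unique lang unfolding U_def by auto
  next
    fix u assume "u \<in> U"
    then have u: "set u \<subseteq> {0,1}" "length (u @ 2 # rev u) = 2 * m + 1" unfolding U_def by auto
    then have "u @ 2 # rev u \<in> G_lang Heisenberg \<delta> q0 Qa"
      unfolding lang marked_palindromes_def by blast
    then obtain k qf where k: "k \<le> t (2 * m + 1)" "qf \<in> Qa"
      and run: "comp Heisenberg \<delta> q0 (mat 1) (u @ 2 # rev u) k qf (mat 1)"
      using time u(2) unfolding weakly_time_bounded_def accepts_in_def by fastforce
    obtain k1 k2 q x where run1: "comp Heisenberg \<delta> q0 (mat 1) u k1 q x"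
      and run2: "comp Heisenberg \<delta> q x (2 # rev u) k2 qf (mat 1)" and "k = k1 + k2"
      using comp_split[OF run] by blast
    have "q \<in> Q"
      using comp_state_in_states[OF run1 aut] aut unfolding is_G_automaton_def by blast
    moreover have "(k1 * r)\<^sup>2 \<le> R"
      unfolding R_def using k(1) \<open>k = k1 + k2\<close> by (intro power_mono mult_le_mono1) simp_all
    then have "x \<in> Heisenberg_ball R"
      using comp_Heisenberg_register_bound[OF labels run1] Heisenberg_ball_mono by blast
    ultimately show "\<exists>(q, x) \<in> Q \<times> Heisenberg_ball R. (\<exists>k. comp Heisenberg \<delta> q0 \<one>\<^bsub>Heisenberg\<^esub> u k q x) \<and>
        (\<exists>k qf. qf \<in> Qa \<and> comp Heisenberg \<delta> q x (2 # rev u) k qf \<one>\<^bsub>Heisenberg\<^esub>)"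
      using run1 run2 k(2) by auto
  qed
  moreover have "card U = 2 ^ m"
    using card_lists_length_eq[of "{0,1::nat}" m] unfolding U_def by (simp add: numeral_2_eq_2)
  moreover have "card (Q \<times> Heisenberg_ball R) \<le> card Q * (2 * R + 1) ^ 3"
    using Heisenberg_ball_finite_card[of R] by (simp add: card_cartesian_product)
  ultimately show ?thesis unfolding R_def by simp
qed

lemma linear_bound_of_bigo:
  assumes "(\<lambda>n. real (t n)) \<in> O(\<lambda>n. real n)"
  obtains C :: nat where "\<forall>\<^sub>F n in at_top. t n \<le> C * n"
proof -
  obtain c where "\<forall>\<^sub>F n in at_top. norm (real (t n)) \<le> c * norm (real n)"
    using landau_o.bigE[OF assms] by blast
  then have "\<forall>\<^sub>F n in at_top. t n \<le> nat \<lceil>c\<rceil> * n"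
  proof (rule eventually_mono)
    fix n assume "norm (real (t n)) \<le> c * norm (real n)"
    also have "c * norm (real n) \<le> real (nat \<lceil>c\<rceil>) * real n"
      using real_nat_ceiling_ge[of c] by (simp add: mult_right_mono)
    finally show "t n \<le> nat \<lceil>c\<rceil> * n" by (simp flip: of_nat_mult)
  qed
  then show thesis by (rule that)
qed

lemma polynomial_below_exponential:
  fixes K a :: nat
  shows "\<forall>\<^sub>F m in at_top. K * (2 * (a * (2 * m + 1))\<^sup>2 + 1) ^ 3 < 2 ^ m"
proof -
  define D where "D = K * (2 * a\<^sup>2 + 1) ^ 3"
  have bound: "K * (2 * (a * n)\<^sup>2 + 1) ^ 3 \<le> D * n ^ 6" if "1 \<le> n" for n :: nat
  proof -
    have "2 * (a * n)\<^sup>2 + 1 \<le> (2 * a\<^sup>2 + 1) * n\<^sup>2"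
      using that by (simp add: power_mult_distrib algebra_simps)
    then have "(2 * (a * n)\<^sup>2 + 1) ^ 3 \<le> ((2 * a\<^sup>2 + 1) * n\<^sup>2) ^ 3"
      by (rule power_mono) simp
    also have "\<dots> = (2 * a\<^sup>2 + 1) ^ 3 * n ^ 6"
      unfolding power_mult_distrib power_mult[symmetric] by simp
    finally show ?thesis unfolding D_def mult.assoc by (rule mult_le_mono2)
  qed
  have "\<forall>\<^sub>F m in at_top. real D * (2 * real m + 1) ^ 6 < 2 ^ m"
    by real_asymp
  then show ?thesis
  proof (rule eventually_mono)
    fix m :: nat assume "real D * (2 * real m + 1) ^ 6 < 2 ^ m"
    then have "real (D * (2 * m + 1) ^ 6) < real (2 ^ m)" by (simp add: add.commute)
    then have "D * (2 * m + 1) ^ 6 < 2 ^ m" by (simp only: of_nat_less_iff)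
    then show "K * (2 * (a * (2 * m + 1))\<^sup>2 + 1) ^ 3 < 2 ^ m"
      using bound[of "2 * m + 1"] by simp
  qed
qed

lemma marked_palindromes_not_in_lin_weak_class_Heisenberg:
  "marked_palindromes \<notin> lin_weak_class Heisenberg"
proof
  assume "marked_palindromes \<in> lin_weak_class Heisenberg"
  then obtain Q \<Sigma> \<delta> q0 Qa t where aut: "is_G_automaton Heisenberg Q \<Sigma> \<delta> q0 Qa"
    and lang: "marked_palindromes = G_lang Heisenberg \<delta> q0 Qa"
    and linear: "(\<lambda>n. real (t n)) \<in> O(\<lambda>n. real n)"
    and time: "weakly_time_bounded Heisenberg \<delta> q0 Qa t"
    unfolding lin_weak_class_def by blast
  obtain r where labels: "transition_labels \<delta> \<subseteq> Heisenberg_ball r"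
    using Heisenberg_ball_covers_finite transition_labels_finite[OF aut] by blast
  obtain C where "\<forall>\<^sub>F n in at_top. t n \<le> C * n"
    using linear_bound_of_bigo[OF linear] by blast
  moreover have "filterlim (\<lambda>m::nat. 2 * m + 1) at_top at_top"
    by (intro filterlim_subseq strict_monoI) simp
  ultimately have "\<forall>\<^sub>F m in at_top. t (2 * m + 1) \<le> C * (2 * m + 1)"
    by (rule eventually_compose_filterlim)
  with polynomial_below_exponential[of "card Q" "C * r"]
  have "\<forall>\<^sub>F m :: nat in at_top. False"
  proof (rule eventually_elim2)
    fix m assume small: "card Q * (2 * (C * r * (2 * m + 1))\<^sup>2 + 1) ^ 3 < 2 ^ m"
      and t: "t (2 * m + 1) \<le> C * (2 * m + 1)"
    have "t (2 * m + 1) * r \<le> C * r * (2 * m + 1)"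
      using mult_le_mono1[OF t, of r] by (simp only: mult_ac)
    then have "(t (2 * m + 1) * r)\<^sup>2 \<le> (C * r * (2 * m + 1))\<^sup>2"
      by (rule power_mono) simp
    then have "card Q * (2 * (t (2 * m + 1) * r)\<^sup>2 + 1) ^ 3 \<le> card Q * (2 * (C * r * (2 * m + 1))\<^sup>2 + 1) ^ 3"
      by (intro mult_le_mono2 power_mono) simp_all
    moreover have "2 ^ m \<le> card Q * (2 * (t (2 * m + 1) * r)\<^sup>2 + 1) ^ 3"
      using marked_palindromes_Heisenberg_count[OF aut lang[symmetric] time labels] .
    ultimately show False using small by linarith
  qed
  then show False by simp
qed

lemma lin_weak_class_Heisenberg_subset_SL3Z: "lin_weak_class Heisenberg \<subseteq> lin_weak_class SL3Z"
  by (rule lin_weak_class_mono) (simp_all add: Heisenberg_carrier_subset_SL3Z)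

theorem theorem4p9:
  shows "(lin_weak_class Heisenberg :: 'a list set set) \<subseteq> lin_weak_class SL3Z \<and>
         (lin_weak_class Heisenberg :: nat list set set) \<subset> lin_weak_class SL3Z"
proof
  show "(lin_weak_class Heisenberg :: 'a list set set) \<subseteq> lin_weak_class SL3Z"
    by (rule lin_weak_class_Heisenberg_subset_SL3Z)
  show "(lin_weak_class Heisenberg :: nat list set set) \<subset> lin_weak_class SL3Z"
    using lin_weak_class_Heisenberg_subset_SL3Z marked_palindromes_in_lin_weak_class_SL3Z
      marked_palindromes_not_in_lin_weak_class_Heisenberg
    by blast
qed

end
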